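(* Let $C_n$ be the cycle on $n$ vertices and $P_n$ the path on $n$ vertices. For all even and sufficiently large $n$, $$\hat{R}(C_n,P_n)\le 2257\, n.$$
   Context: All graphs are finite and simple. For graphs $F,H$, write $G\to(F,H)$ if every colouring of the edges of $G$ with two colours, red and blue, yields a red copy of $F$ or a blue copy of $H$ (copies are not necessarily induced subgraphs). The size-Ramsey number is $\hat{R}(F,H)=\min\{|E(G)| : G\to(F,H)\}$. *)

theory Defs
  imports "HOL-Library.Ramsey" "HOL-Library.Extended_Nat" Complex_Main
begin

record 'a ugraph =
  verts :: "'a set"
  edges :: "'a set set"

definition finite_simple_graph :: "'a ugraph \<Rightarrow> bool" where
  "finite_simple_graph G \<longleftrightarrow> finite (verts G) \<and> edges G \<subseteq> [verts G]\<^bsup>2\<^esup>"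

text \<open>Copies are subgraphs, not necessarily induced.\<close>

definition contains_copy :: "'a ugraph \<Rightarrow> 'b ugraph \<Rightarrow> bool" where
  "contains_copy G F \<longleftrightarrow>
     (\<exists>f. inj_on f (verts F) \<and> f ` verts F \<subseteq> verts G \<and> (\<forall>e\<in>edges F. f ` e \<in> edges G))"

datatype colour = Red | Blue

definition colour_class :: "'a ugraph \<Rightarrow> ('a set \<Rightarrow> colour) \<Rightarrow> colour \<Rightarrow> 'a ugraph" where
  "colour_class G c k = \<lparr>verts = verts G, edges = {e \<in> edges G. c e = k}\<rparr>"

text \<open>A colouring is a total function, of which only the values on the edges of \<open>G\<close> matter.\<close>

definition arrows :: "'a ugraph \<Rightarrow> 'b ugraph \<Rightarrow> 'c ugraph \<Rightarrow> bool" where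
  "arrows G F H \<longleftrightarrow>
     (\<forall>c. contains_copy (colour_class G c Red) F \<or> contains_copy (colour_class G c Blue) H)"

text \<open>
  Host graphs may be taken on natural numbers, as every finite graph is isomorphic to one of these.
  The infimum is a minimum unless no graph arrows \<open>(F, H)\<close>; in that case it would be \<open>\<infinity>\<close>, so that
  an upper bound on it always provides a host graph.
\<close>

definition size_ramsey :: "'a ugraph \<Rightarrow> 'b ugraph \<Rightarrow> enat" where
  "size_ramsey F H =
     Inf {enat (card (edges G)) | G :: nat ugraph. finite_simple_graph G \<and> arrows G F H}"

lemma size_ramsey_le_iff:
  "size_ramsey F H \<le> enat m \<longleftrightarrow>
     (\<exists>G :: nat ugraph. finite_simple_graph G \<and> arrows G F H \<and> card (edges G) \<le> m)"
  (is "?L \<longleftrightarrow> ?R")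
proof
  let ?S = "{enat (card (edges G)) | G :: nat ugraph. finite_simple_graph G \<and> arrows G F H}"
  assume L: ?L
  have "?S \<noteq> {}"
  proof
    assume "?S = {}"
    then have "size_ramsey F H = \<infinity>"
      unfolding size_ramsey_def by (simp only: Inf_empty top_enat_def)
    then show False
      using L by simp
  qed
  then have "Inf ?S \<in> ?S"
    unfolding Inf_enat_def using LeastI_ex[of "\<lambda>x. x \<in> ?S"] by (simp only: if_False) blast
  then obtain G :: "nat ugraph"
    where "finite_simple_graph G" "arrows G F H" "size_ramsey F H = enat (card (edges G))"
    unfolding size_ramsey_def by blast
  then show ?R
    using L by auto
next
  assume ?R
  then obtain G :: "nat ugraph"
    where G: "finite_simple_graph G" "arrows G F H" "card (edges G) \<le> m"
    by blast
  have "size_ramsey F H \<le> enat (card (edges G))"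
    unfolding size_ramsey_def using G by (intro Inf_lower) blast
  then show ?L
    using G(3) by (meson enat_ord_simps(1) order_trans)
qed

text \<open>Meant for \<open>n \<ge> 3\<close>.\<close>

definition cycle_graph :: "nat \<Rightarrow> nat ugraph" where
  "cycle_graph n = \<lparr>verts = {..<n}, edges = {{i, (i + 1) mod n} | i. i < n}\<rparr>"

text \<open>The index is the number of vertices, so there are \<open>n - 1\<close> edges.\<close>

definition path_graph :: "nat \<Rightarrow> nat ugraph" where
  "path_graph n = \<lparr>verts = {..<n}, edges = {{i, i + 1} | i. i + 1 < n}\<rparr>"

lemma finite_simple_path_graph: "finite_simple_graph (path_graph n)"
  by (auto simp: finite_simple_graph_def path_graph_def nsets_def)

lemma finite_simple_cycle_graph: "n \<ge> 3 \<Longrightarrow> finite_simple_graph (cycle_graph n)"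
  by (auto simp: finite_simple_graph_def cycle_graph_def nsets_def card_insert_if mod_Suc)

end

theory Submission
  imports Defs
begin

text \<open>
  The host is a sparse graph on \<open>80 * k\<close> vertices, with \<open>k\<close> about \<open>n / 16\<close>, in which any two disjoint
  \<open>k\<close>-sets are joined by an edge. If it has no blue path on \<open>n\<close> vertices, depth-first search in blue
  gives disjoint \<open>S\<close> and \<open>T\<close> of size at least \<open>32 * k\<close> with only red edges in between. Reserve two
  disjoint regions of \<open>10 * k\<close> vertices on either side. After removal of fewer than \<open>k\<close> vertices per
  side and region, every set of at most \<open>k\<close> vertices on one side expands by a factor of 4 into each
  region, and a second depth-first search finds a path of length about \<open>16 * k\<close> outside the regions.
  Cut it down to \<open>n - 2 * h\<close> vertices, where \<open>h\<close> is minimal with \<open>k \<le> 2 ^ h\<close>, and grow from its two ends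
  binary trees of depth exactly \<open>h\<close>, each in a region of its own. As \<open>n\<close> is even, the two sets of
  leaves lie on opposite sides, and an edge between them closes a red cycle on exactly \<open>n\<close> vertices.
\<close>

section \<open>Sparse graphs joining all pairs of disjoint k-sets\<close>

text \<open>By averaging, some point of \<open>\<Omega>\<close> lies in at least a
  \<open>\<delta>\<close>-fraction of the sets not yet hit. Choosing such a point \<open>m\<close>
  times multiplies the number of missed sets by at most \<open>1 - \<delta>\<close> each
  time.\<close>

lemma greedy_hitting_set:
  fixes \<Omega> :: "'a set" and \<delta> :: real
  assumes "finite \<Omega>" "finite \<F>" and sub: "\<And>X. X \<in> \<F> \<Longrightarrow> X \<subseteq> \<Omega>"
    and dens: "\<And>X. X \<in> \<F> \<Longrightarrow> \<delta> * card \<Omega> \<le> card X"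
    and "\<delta> \<le> 1" "{} \<notin> \<F>"
  shows "\<exists>H\<subseteq>\<Omega>. card H \<le> m \<and> card {X \<in> \<F>. X \<inter> H = {}} \<le> card \<F> * (1 - \<delta>) ^ m"
proof (induction m)
  case 0
  show ?case by (intro exI[of _ "{}"]) (simp add: card_mono assms)
next
  case (Suc m)
  then obtain H where H: "H \<subseteq> \<Omega>" "card H \<le> m"
    "card {X \<in> \<F>. X \<inter> H = {}} \<le> card \<F> * (1 - \<delta>) ^ m" by blast
  define \<U> where "\<U> = {X \<in> \<F>. X \<inter> H = {}}"
  have finU: "finite \<U>" using assms by (simp add: \<U>_def)
  have "\<exists>H\<subseteq>\<Omega>. card H \<le> Suc m \<and> card {X \<in> \<F>. X \<inter> H = {}} \<le> (1 - \<delta>) * card \<U>"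
  proof (cases "\<U> = {}")
    case True
    with H show ?thesis by (intro exI[of _ H]) (auto simp flip: \<U>_def)
  next
    case False
    have "\<exists>w\<in>\<Omega>. \<delta> * card \<U> \<le> card {X \<in> \<U>. w \<in> X}"
    proof (rule ccontr)
      have ne: "\<Omega> \<noteq> {}" using False sub assms(6) by (fastforce simp: \<U>_def)
      assume "\<not> ?thesis"
      then have "(\<Sum>w\<in>\<Omega>. real (card {X \<in> \<U>. w \<in> X})) < (\<Sum>w\<in>\<Omega>. \<delta> * card \<U>)"
        using ne assms by (intro sum_strict_mono) auto
      also have "(\<Sum>w\<in>\<Omega>. real (card {X \<in> \<U>. w \<in> X})) = (\<Sum>X\<in>\<U>. real (card X))"
      proof -
        \<comment> \<open>Double counting of the incidences between points and the sets missed so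
          far.\<close>
        have "(\<Sum>w\<in>\<Omega>. card {X \<in> \<U>. w \<in> X}) = (\<Sum>X\<in>\<U>. card {w \<in> \<Omega>. w \<in> X})"
          using sum_multicount_gen[OF assms(1) finU, of "\<lambda>w X. w \<in> X" "\<lambda>X. card {w \<in> \<Omega>. w \<in> X}"]
          by simp
        also have "\<dots> = (\<Sum>X\<in>\<U>. card X)"
          using sub by (intro sum.cong refl arg_cong[where f = card]) (auto simp: \<U>_def)
        finally show ?thesis by (simp flip: of_nat_sum)
      qed
      also have "(\<Sum>w\<in>\<Omega>. \<delta> * card \<U>) = (\<Sum>X\<in>\<U>. \<delta> * card \<Omega>)" by simp
      finally show False
        using sum_mono[of \<U> "\<lambda>_. \<delta> * card \<Omega>" "\<lambda>X. real (card X)"] dens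
        by (auto simp: \<U>_def)
    qed
    then obtain w where w: "w \<in> \<Omega>" "\<delta> * card \<U> \<le> card {X \<in> \<U>. w \<in> X}" by blast
    have "{X \<in> \<F>. X \<inter> insert w H = {}} = \<U> - {X \<in> \<U>. w \<in> X}" by (auto simp: \<U>_def)
    then have "real (card {X \<in> \<F>. X \<inter> insert w H = {}}) = real (card \<U>) - card {X \<in> \<U>. w \<in> X}"
      using finU by (simp add: card_Diff_subset of_nat_diff card_mono)
    then have "card {X \<in> \<F>. X \<inter> insert w H = {}} \<le> (1 - \<delta>) * card \<U>"
      using w by (simp add: algebra_simps)
    moreover have "card (insert w H) \<le> Suc m"
      using H(2) finite_subset[OF H(1) assms(1)] by (simp add: card_insert_if)
    ultimately show ?thesis using w H by (intro exI[of _ "insert w H"]) auto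
  qed
  then obtain H' where H': "H' \<subseteq> \<Omega>" "card H' \<le> Suc m" "card {X \<in> \<F>. X \<inter> H' = {}} \<le> (1 - \<delta>) * card \<U>"
    by blast
  have "(1 - \<delta>) * card \<U> \<le> (1 - \<delta>) * (card \<F> * (1 - \<delta>) ^ m)"
    using H(3) \<open>\<delta> \<le> 1\<close> by (intro mult_left_mono) (auto simp: \<U>_def)
  with H' show ?case by (intro exI[of _ H']) (auto simp: algebra_simps)
qed

text \<open>\<open>k ^ k / fact k\<close> is a single term of the exponential series at
  \<open>k\<close>. This is what turns a binomial coefficient into a power of
  \<open>exp 1 * r\<close> below.\<close>

lemma power_self_le_exp_fact: "real k ^ k \<le> exp k * fact k"
proof -
  have "real k ^ k / fact k \<le> exp (real k)"
  proof -
    have "(\<Sum>i\<in>{k}. real k ^ i /\<^sub>R fact i) \<le> (\<Sum>i. real k ^ i /\<^sub>R fact i)"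
      by (intro sum_le_suminf summable_exp_generic) auto
    then show ?thesis by (simp add: exp_def divide_inverse mult.commute)
  qed
  then show ?thesis by (simp add: field_simps)
qed

lemma binomial_multiple_le: "real ((r * k) choose k) \<le> (exp 1 * r) ^ k"
proof -
  have "real ((r * k) choose k) * fact k \<le> real (r * k) ^ k"
    using binomial_fact_pow[of "r * k" k]
    by (metis of_nat_fact of_nat_le_iff of_nat_mult of_nat_power)
  also have "\<dots> = real r ^ k * real k ^ k" by (simp add: power_mult_distrib)
  also have "\<dots> \<le> real r ^ k * (exp k * fact k)"
    by (intro mult_left_mono power_self_le_exp_fact) auto
  also have "\<dots> = (exp 1 * r) ^ k * fact k"
    by (simp add: power_mult_distrib exp_of_nat_mult[of k 1, simplified])
  finally show ?thesis by simp
qed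

text \<open>An edge set joins \<open>A\<close> to \<open>B\<close> exactly when it meets this set,
  so joining many pairs of sets becomes a hitting set problem.\<close>

definition biclique :: "'a set \<Rightarrow> 'a set \<Rightarrow> 'a set set" where
  "biclique A B = (\<lambda>(a, b). {a, b}) ` (A \<times> B)"

lemma card_biclique:
  assumes "A \<inter> B = {}"
  shows "card (biclique A B) = card A * card B"
proof -
  have "inj_on (\<lambda>(a, b). {a, b}) (A \<times> B)"
    using assms by (auto simp: inj_on_def doubleton_eq_iff)
  then show ?thesis by (simp add: biclique_def card_image card_cartesian_product)
qed

text \<open>There are at most \<open>exp (2 * k * (1 + ln r))\<close> bicliques between disjoint
  k-sets, and each contains at least the fraction \<open>2 / r ^ 2\<close> of all pairs, as
  \<open>k ^ 2\<close> is compared with at most \<open>(r * k) ^ 2 / 2\<close>. After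
  \<open>m\<close> greedy choices at most \<open>exp (2 * k * (1 + ln r) - 2 * m / r ^ 2)\<close>
  bicliques are missed, and the bound on \<open>m\<close> makes this less than 1, hence 0.\<close>

lemma sparse_joined_graph_exists:
  fixes r k m :: nat
  assumes "k > 0" "r > 1" and m: "r\<^sup>2 * k * (1 + ln r) < m"
  shows "\<exists>H \<subseteq> [{..<r * k}]\<^bsup>2\<^esup>. card H \<le> m \<and>
    (\<forall>A B. A \<subseteq> {..<r * k} \<longrightarrow> B \<subseteq> {..<r * k} \<longrightarrow> A \<inter> B = {} \<longrightarrow> k \<le> card A \<longrightarrow> k \<le> card B \<longrightarrow>
      (\<exists>a\<in>A. \<exists>b\<in>B. {a, b} \<in> H))"
proof -
  define \<Omega> where "\<Omega> = [{..<r * k}]\<^bsup>2\<^esup>"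
  define \<P> where "\<P> = {(A, B). A \<in> [{..<r * k}]\<^bsup>k\<^esup> \<and> B \<in> [{..<r * k}]\<^bsup>k\<^esup> \<and> A \<inter> B = {}}"
  define \<F> where "\<F> = (\<lambda>(A, B). biclique A B) ` \<P>"
  define \<delta> where "\<delta> = 2 / (real r)\<^sup>2"
  have Psub: "\<P> \<subseteq> [{..<r * k}]\<^bsup>k\<^esup> \<times> [{..<r * k}]\<^bsup>k\<^esup>" by (auto simp: \<P>_def)
  have finP: "finite \<P>" by (rule finite_subset[OF Psub]) (simp add: finite_imp_finite_nsets)
  have finO: "finite \<Omega>" by (simp add: \<Omega>_def finite_imp_finite_nsets)
  have r2: "2 \<le> (real r)\<^sup>2"
    using power_mono[of 2 "real r" 2] assms by simp
  have "\<delta> \<le> 1" using r2 assms(2) by (simp add: \<delta>_def divide_le_eq_1)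
  have cO: "\<delta> * card \<Omega> \<le> k * k"
  proof -
    have "2 * (n choose 2) \<le> n * n" for n :: nat
      using choose_two[of n] mult_le_mono2[of "n - 1" n n] by linarith
    then have "2 * card \<Omega> \<le> (r * k) * (r * k)"
      by (simp add: \<Omega>_def card_nsets)
    then have "2 * real (card \<Omega>) \<le> (real r)\<^sup>2 * (k * k)"
      by (simp add: power2_eq_square algebra_simps flip: of_nat_mult)
    then show ?thesis using assms by (simp add: \<delta>_def field_simps)
  qed
  have "card \<F> \<le> card \<P>" unfolding \<F>_def by (rule card_image_le[OF finP])
  also have "\<dots> \<le> ((r * k) choose k) * ((r * k) choose k)"
    using card_mono[OF _ Psub] by (simp add: finite_imp_finite_nsets card_cartesian_product card_nsets)
  finally have "real (card \<F>) \<le> real ((r * k) choose k) * real ((r * k) choose k)"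
    by (metis of_nat_le_iff of_nat_mult)
  also have "\<dots> \<le> (exp 1 * r) ^ k * (exp 1 * r) ^ k"
    by (intro mult_mono binomial_multiple_le) auto
  also have "exp 1 * r = exp (1 + ln r)" using assms by (simp add: exp_add)
  also have "exp (1 + ln r) ^ k * exp (1 + ln r) ^ k = exp (2 * k * (1 + ln r))"
    by (simp add: algebra_simps flip: exp_of_nat_mult exp_add)
  finally have cF: "card \<F> \<le> exp (2 * k * (1 + ln r))" .
  obtain H where H: "H \<subseteq> \<Omega>" "card H \<le> m" "card {X \<in> \<F>. X \<inter> H = {}} \<le> card \<F> * (1 - \<delta>) ^ m"
  proof -
    have "\<exists>H\<subseteq>\<Omega>. card H \<le> m \<and> card {X \<in> \<F>. X \<inter> H = {}} \<le> card \<F> * (1 - \<delta>) ^ m"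
    proof (rule greedy_hitting_set)
      fix X assume "X \<in> \<F>"
      then obtain A B where AB: "X = biclique A B" "A \<in> [{..<r * k}]\<^bsup>k\<^esup>" "B \<in> [{..<r * k}]\<^bsup>k\<^esup>" "A \<inter> B = {}"
        by (auto simp: \<F>_def \<P>_def)
      show "X \<subseteq> \<Omega>" using AB by (auto simp: biclique_def \<Omega>_def nsets_def card_insert_if)
      show "\<delta> * card \<Omega> \<le> card X" using cO AB by (simp add: card_biclique nsets_def)
    qed (use finO finP \<open>\<delta> \<le> 1\<close> \<open>k > 0\<close> in \<open>auto simp: \<F>_def \<P>_def biclique_def nsets_def\<close>)
    then show ?thesis using that by blast
  qed
  have "(1 - \<delta>) ^ m \<le> exp (- \<delta>) ^ m"
    using \<open>\<delta> \<le> 1\<close> exp_ge_add_one_self[of "-\<delta>"] by (intro power_mono) auto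
  also have "\<dots> = exp (- (\<delta> * m))" by (simp add: mult.commute flip: exp_of_nat_mult)
  finally have "card \<F> * (1 - \<delta>) ^ m \<le> exp (2 * k * (1 + ln r)) * exp (- (\<delta> * m))"
    using cF \<open>\<delta> \<le> 1\<close> by (intro mult_mono) auto
  also have "\<dots> = exp (2 * k * (1 + ln r) - \<delta> * m)" by (simp flip: exp_add)
  also have "\<dots> < 1"
    using m assms by (simp add: \<delta>_def field_simps)
  finally have "card {X \<in> \<F>. X \<inter> H = {}} = 0" using H(3) by linarith
  then have hit: "X \<inter> H \<noteq> {}" if "X \<in> \<F>" for X
    using that finP by (auto simp: \<F>_def)
  show ?thesis
  proof (intro exI[of _ H] conjI allI impI)
    fix A B assume AB: "A \<subseteq> {..<r * k}" "B \<subseteq> {..<r * k}" "A \<inter> B = {}" "k \<le> card A" "k \<le> card B"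
    obtain A' where A': "A' \<subseteq> A" "card A' = k" using AB(4) by (meson obtain_subset_with_card_n)
    obtain B' where B': "B' \<subseteq> B" "card B' = k" using AB(5) by (meson obtain_subset_with_card_n)
    have "finite A'" "finite B'" using A' B' AB by (meson finite_subset finite_lessThan)+
    then have "biclique A' B' \<in> \<F>" unfolding \<F>_def \<P>_def using A' B' AB
      by (intro image_eqI[of _ _ "(A', B')"]) (auto simp: nsets_def)
    from hit[OF this] show "\<exists>a\<in>A. \<exists>b\<in>B. {a, b} \<in> H" using A' B' by (fastforce simp: biclique_def)
  qed (use H in \<open>auto simp: \<Omega>_def\<close>)
qed

section \<open>Depth-first search and alternating lists\<close>

text \<open>
  Depth-first search with finished vertices \<open>A\<close>, stack \<open>p\<close> and unvisited vertices \<open>B\<close>: every step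
  lowers \<open>card B - card A\<close> by exactly one, so at some moment the two are equal.
\<close>
lemma depth_first_search_partition:
  assumes "finite V" and sym: "\<And>x y. E x y \<Longrightarrow> E y x"
  shows "\<exists>A p B. A \<union> set p \<union> B = V \<and> A \<inter> B = {} \<and> (A \<union> B) \<inter> set p = {} \<and> distinct p \<and>
    successively E p \<and> (\<forall>a\<in>A. \<forall>b\<in>B. \<not> E a b) \<and> card A = card B"
proof -
  \<comment> \<open>\<open>j\<close> counts the steps made. The equation states
    \<open>card B - card A = card V - j\<close> without truncated subtraction or negative
    values.\<close>
  have "j \<le> card V \<Longrightarrow> \<exists>A p B. A \<union> set p \<union> B = V \<and> A \<inter> B = {} \<and> (A \<union> B) \<inter> set p = {} \<and> distinct p \<and>
    successively E p \<and> (\<forall>a\<in>A. \<forall>b\<in>B. \<not> E a b) \<and> card A + card V = card B + j" for j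
  proof (induction j)
    case 0
    show ?case by (rule exI[of _ "{}"], rule exI[of _ "[]"], rule exI[of _ V]) auto
  next
    case (Suc j)
    then obtain A p B where *: "A \<union> set p \<union> B = V" "A \<inter> B = {}" "(A \<union> B) \<inter> set p = {}" "distinct p"
      "successively E p" "\<forall>a\<in>A. \<forall>b\<in>B. \<not> E a b" "card A + card V = card B + j" by auto
    have fin: "finite A" "finite B" using *(1) assms by auto
    have push: ?case if b: "b \<in> B" "successively E (b # p)" for b
    proof (rule exI[of _ A], rule exI[of _ "b # p"], rule exI[of _ "B - {b}"], intro conjI)
      show "card A + card V = card (B - {b}) + Suc j" using * fin b card_Suc_Diff1[of B b] by simp
    qed (use * b in auto)
    show ?case
    proof (cases p)
      case Nil
      \<comment> \<open>If the stack and \<open>B\<close> were both empty, \<open>A\<close> would be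
        \<open>V\<close> and \<open>j\<close> would be \<open>2 * card V\<close>, although
        \<open>j < card V\<close>.\<close>
      have "B \<noteq> {}" using * Suc.prems by auto
      then show ?thesis using push Nil by auto
    next
      case (Cons x p')
      show ?thesis
      proof (cases "\<exists>b\<in>B. E b x")
        case True
        then show ?thesis using push * Cons by auto
      next
        case False
        show ?thesis
        proof (rule exI[of _ "insert x A"], rule exI[of _ p'], rule exI[of _ B], intro conjI)
          show "card (insert x A) + card V = card B + Suc j" using * fin Cons by auto
          show "successively E p'" using * Cons by (cases p') auto
        qed (use * Cons False sym in auto)
      qed
    qed
  qed
  from this[of "card V"] show ?thesis by simp
qed

text \<open>Dropping the first two entries drops at most one that satisfies \<open>P\<close>. The
  \<open>+ 1\<close> allows for lists of odd length that begin and end in \<open>P\<close>.\<close>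

lemma alternating_list_filter_bound:
  "successively (\<lambda>x y. \<not> (P x \<and> P y)) xs \<Longrightarrow> 2 * length (filter P xs) \<le> length xs + 1"
  proof (induction xs rule: induct_list012)
  case (3 x y zs)
  then have "successively (\<lambda>x y. \<not> (P x \<and> P y)) zs" by (cases zs) auto
  with 3 show ?case by auto
qed auto

section \<open>Expansion, trees and long paths in a bipartite relation\<close>

text \<open>The sides are indexed by \<open>bool\<close>, so that \<open>\<not> b\<close> is the
  side opposite to \<open>b\<close> and each argument is given once for both. In the application
  \<open>E\<close> consists of the red edges between the two sets that depth-first search
  leaves.\<close>

locale bipartite_relation =
  fixes V :: "bool \<Rightarrow> 'a set" and E :: "'a \<Rightarrow> 'a \<Rightarrow> bool" and k :: nat
  assumes sym: "E x y \<Longrightarrow> E y x"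
    and cross: "E x y \<Longrightarrow> x \<in> V b \<Longrightarrow> y \<notin> V b"
    and fin: "finite (V b)"
    and joined: "A \<subseteq> V b \<Longrightarrow> C \<subseteq> V (\<not> b) \<Longrightarrow> k \<le> card A \<Longrightarrow> k \<le> card C \<Longrightarrow> \<exists>x\<in>A. \<exists>y\<in>C. E x y"
    and disj: "V True \<inter> V False = {}"
begin

lemma sides_disjoint: "V b \<inter> V (\<not> b) = {}"
  using disj by (cases b) auto

abbreviation nbhd :: "'a set \<Rightarrow> 'a set \<Rightarrow> 'a set" where
  "nbhd X U \<equiv> {y \<in> U. \<exists>x\<in>X. E x y}"

text \<open>Among the pairs of sets below size \<open>k\<close> that have few neighbours in what
  remains of the opposite region, \<open>B\<close> is one of maximal total size, so it has absorbed
  the badly expanding sets. Both sides are cleaned at once because the target region loses its part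
  of \<open>B\<close> too.\<close>

lemma expanding_cleanup:
  assumes W: "\<And>b. W b \<subseteq> V b" and U: "\<And>b. U b \<subseteq> V b" "\<And>b. 10 * k \<le> card (U b)" and "k > 0"
  shows "\<exists>B. \<forall>b. B b \<subseteq> W b \<and> card (B b) < k \<and>
    (\<forall>X \<subseteq> W b - B b. card X \<le> k \<longrightarrow> 4 * card X \<le> card (nbhd X (U (\<not> b) - B (\<not> b))))"
proof -
  define ok where "ok B \<longleftrightarrow> (\<forall>b. B b \<subseteq> W b \<and> card (B b) < k \<and>
    card (nbhd (B b) (U (\<not> b) - B (\<not> b))) \<le> 4 * card (B b))" for B
  have finW: "finite (W b)" "finite (U b)" for b using W[of b] U(1)[of b] fin finite_subset by blast+
  have "ok (\<lambda>_. {})" using \<open>k > 0\<close> by (simp add: ok_def)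
  moreover have "card (B True) + card (B False) < 2 * k" if "ok B" for B
    using that unfolding ok_def by (metis add_less_mono mult_2)
  ultimately obtain B where B: "ok B" and
    max: "\<And>B'. ok B' \<Longrightarrow> card (B' True) + card (B' False) \<le> card (B True) + card (B False)"
    using ex_has_greatest_nat[of ok "\<lambda>_. {}" "\<lambda>B. card (B True) + card (B False)" "2 * k"]
    by metis
  have Bb: "B b \<subseteq> W b" "card (B b) < k" "card (nbhd (B b) (U (\<not> b) - B (\<not> b))) \<le> 4 * card (B b)" for b
    using B unfolding ok_def by blast+
  have finB: "finite (B b)" for b using Bb(1) finW finite_subset by blast
  show ?thesis
  proof (intro exI[of _ B] allI conjI impI)
    fix b X assume X: "X \<subseteq> W b - B b" "card X \<le> k"
    \<comment> \<open>A violating set could be added to \<open>B\<close>, unless this makes \<open>B b\<close> reach \<open>k\<close>, and then \<open>B b\<close>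
      would miss at least \<open>k\<close> vertices of the region.\<close>
    show "4 * card X \<le> card (nbhd X (U (\<not> b) - B (\<not> b)))"
    proof (rule ccontr)
      assume neg: "\<not> ?thesis"
      have finX: "finite X" using X finW finite_subset by blast
      have "X \<noteq> {}" using neg by auto
      then have "card X > 0" using finX by (simp add: card_gt_0_iff)
      define B' where "B' = B(b := B b \<union> X)"
      have c': "card (B b \<union> X) = card (B b) + card X"
        using X finX finB by (intro card_Un_disjoint) auto
      have "nbhd (B b \<union> X) (U (\<not> b) - B (\<not> b)) =
          nbhd (B b) (U (\<not> b) - B (\<not> b)) \<union> nbhd X (U (\<not> b) - B (\<not> b))" by auto
      then have "card (nbhd (B b \<union> X) (U (\<not> b) - B (\<not> b))) \<le>
          card (nbhd (B b) (U (\<not> b) - B (\<not> b))) + card (nbhd X (U (\<not> b) - B (\<not> b)))"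
        by (simp add: card_Un_le)
      also have "card (nbhd (B b) (U (\<not> b) - B (\<not> b))) \<le> 4 * card (B b)" by (rule Bb)
      finally have n1: "card (nbhd (B b \<union> X) (U (\<not> b) - B (\<not> b))) \<le> 4 * card (B b \<union> X)"
        using neg c' by simp
      \<comment> \<open>For the opposite part of \<open>B\<close> only the target region shrinks, so
        its bound survives the enlargement.\<close>
      have "card (nbhd (B (\<not> b)) (U b - (B b \<union> X))) \<le> card (nbhd (B (\<not> b)) (U b - B b))"
        using finW by (intro card_mono) auto
      also have "\<dots> \<le> 4 * card (B (\<not> b))" using Bb(3)[of "\<not> b"] by simp
      finally have n2: "card (nbhd (B (\<not> b)) (U b - (B b \<union> X))) \<le> 4 * card (B (\<not> b))" .
      show False
      proof (cases "card (B b \<union> X) < k")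
        case True
        have "ok B'" unfolding ok_def
        proof (intro allI)
          fix b'
          show "B' b' \<subseteq> W b' \<and> card (B' b') < k \<and> card (nbhd (B' b') (U (\<not> b') - B' (\<not> b'))) \<le> 4 * card (B' b')"
          proof (cases "b' = b")
            case eq: True
            have "B b \<union> X \<subseteq> W b" using Bb(1)[of b] X by blast
            then show ?thesis using n1 True unfolding eq B'_def by simp
          next
            case False
            then have eq: "b' = (\<not> b)" by auto
            show ?thesis using Bb(1,2)[of "\<not> b"] n2 unfolding eq B'_def by simp
          qed
        qed
        from max[OF this] show False
          using c' \<open>card X > 0\<close> by (cases b) (auto simp: B'_def)
      next
        case False
        \<comment> \<open>The enlarged set has fewer than \<open>2 * k\<close> vertices, hence fewer
          than \<open>8 * k\<close> neighbours in the cleaned region. The cleanup took fewer than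
          \<open>k\<close> from the region, so of its \<open>10 * k\<close> vertices at least
          \<open>k\<close> are left in \<open>Y\<close>.\<close>
        define Y where "Y = U (\<not> b) - B (\<not> b) - nbhd (B b \<union> X) (U (\<not> b) - B (\<not> b))"
        have lt: "card (B b) < k" "card (B (\<not> b)) < k" by (rule Bb)+
        have "card (U (\<not> b)) - card (B (\<not> b)) \<le> card (U (\<not> b) - B (\<not> b))"
          by (rule diff_card_le_card_Diff[OF finB])
        moreover have "card (U (\<not> b) - B (\<not> b)) - card (nbhd (B b \<union> X) (U (\<not> b) - B (\<not> b))) \<le> card Y"
          unfolding Y_def using finW by (intro diff_card_le_card_Diff) auto
        ultimately have "k \<le> card Y" using n1 lt c' X(2) U(2)[of "\<not> b"] by linarith
        moreover have "Y \<subseteq> V (\<not> b)" using U by (auto simp: Y_def)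
        moreover have "B b \<union> X \<subseteq> V b" using Bb(1)[of b] X(1) W[of b] by blast
        ultimately obtain x y where "x \<in> B b \<union> X" "y \<in> Y" "E x y"
          using joined[of "B b \<union> X" b Y] False by force
        then show False by (auto simp: Y_def)
      qed
    qed
  qed (rule Bb)+
qed

text \<open>Only the paths from the leaves to the root are recorded, not the tree. The list
  \<open>q\<close> omits the root \<open>v\<close>, which lies outside the region, and reading the
  head from \<open>q @ [v]\<close> covers \<open>i = 0\<close>, where \<open>x\<close> is
  \<open>v\<close>.\<close>

definition linked :: "'a \<Rightarrow> 'a set \<Rightarrow> nat \<Rightarrow> 'a \<Rightarrow> bool" where
  "linked v Z i x \<longleftrightarrow>
    (\<exists>q. length q = i \<and> distinct (q @ [v]) \<and> set q \<subseteq> Z \<and> successively E (q @ [v]) \<and> hd (q @ [v]) = x)"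

text \<open>\<open>Z\<close> collects the region vertices used so far. A level of
  \<open>2 ^ i\<close> vertices has at least \<open>4 * 2 ^ i\<close> neighbours in the region, at
  most \<open>2 * 2 ^ i\<close> of them used, so \<open>2 ^ Suc i\<close> fresh ones form the next
  level. Only levels that are extended need size at most \<open>k\<close>; the last may exceed
  it.\<close>

lemma expanding_tree:
  fixes G U :: "bool \<Rightarrow> 'a set"
  assumes exp: "\<And>b X. X \<subseteq> G b \<Longrightarrow> card X \<le> k \<Longrightarrow> 4 * card X \<le> card (nbhd X (U (\<not> b)))"
    and UG: "\<And>b. U b \<subseteq> G b" and G: "\<And>b. G b \<subseteq> V b"
    and v: "v \<in> G b" "v \<notin> U b" and "\<And>j. j < i \<Longrightarrow> 2 ^ j \<le> k"
  shows "\<exists>X Z. X \<subseteq> G (b = even i) \<and> card X = 2 ^ i \<and> Z \<subseteq> U True \<union> U False \<and> card Z \<le> 2 * 2 ^ i \<and>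
    (\<forall>x\<in>X. linked v Z i x)"
  using assms(6)
proof (induction i)
  case 0
  show ?case by (rule exI[of _ "{v}"], rule exI[of _ "{}"]) (use v in \<open>auto simp: linked_def\<close>)
next
  case (Suc i)
  then obtain X Z where XZ: "X \<subseteq> G (b = even i)" "card X = 2 ^ i" "Z \<subseteq> U True \<union> U False" "card Z \<le> 2 * 2 ^ i"
    and paths: "\<And>x. x \<in> X \<Longrightarrow> linked v Z i x"
    by (metis less_SucI)
  let ?c = "\<not> (b = even i)"
  have UV: "U c \<subseteq> V c" for c using UG G by (rule order_trans)
  have vU: "v \<notin> U c" for c
  proof (cases "c = b")
    case False
    then have "c = (\<not> b)" by auto
    then show ?thesis using v(1) G[of b] UV[of c] sides_disjoint[of b] by blast
  qed (use v in simp)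
  have finU: "finite (U c)" for c using UV fin by (rule finite_subset)
  have finZ: "finite Z" using XZ(3) by (rule finite_subset) (simp add: finU)
  have "card (nbhd X (U ?c)) - card Z \<le> card (nbhd X (U ?c) - Z)"
    by (rule diff_card_le_card_Diff[OF finZ])
  moreover have "4 * 2 ^ i \<le> card (nbhd X (U ?c))" using exp[OF XZ(1)] Suc.prems[of i] by (simp only: XZ(2) lessI)
  ultimately have "2 ^ Suc i \<le> card (nbhd X (U ?c) - Z)" using XZ(4) by simp
  then obtain X' where X': "X' \<subseteq> nbhd X (U ?c) - Z" "card X' = 2 ^ Suc i"
    by (meson obtain_subset_with_card_n)
  have side: "(b = even (Suc i)) = ?c" by auto
  show ?case
  proof (rule exI[of _ X'], rule exI[of _ "Z \<union> X'"], intro conjI ballI)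
    show "X' \<subseteq> G (b = even (Suc i))" unfolding side using X' UG by blast
    show "Z \<union> X' \<subseteq> U True \<union> U False"
      using X' XZ by (cases ?c) auto
    show "card (Z \<union> X') \<le> 2 * 2 ^ Suc i" using card_Un_le[of Z X'] XZ(4) X'(2) by simp
    fix x assume x: "x \<in> X'"
    then obtain y where y: "y \<in> X" "E x y" using X' sym by blast
    from paths[OF y(1)] obtain q where q: "length q = i" "distinct (q @ [v])" "set q \<subseteq> Z"
      "successively E (q @ [v])" "hd (q @ [v]) = y" unfolding linked_def by blast
    have "x \<noteq> v" using x X' vU by blast
    moreover have "x \<notin> Z" using x X' by blast
    moreover have "successively E (x # q @ [v])" using q(4,5) y(2) by (simp add: successively_Cons)
    ultimately show "linked v (Z \<union> X') (Suc i) x"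
      unfolding linked_def using q x by (intro exI[of _ "x # q"]) auto
  qed (use X' in auto)
qed

text \<open>Depth-first search leaves \<open>A\<close> and \<open>B\<close> of equal size with no
  edge between them. By \<open>joined\<close>, one of any two opposite parts of \<open>A\<close> and
  \<open>B\<close> is smaller than \<open>k\<close>.\<close>

lemma long_path:
  assumes W: "\<And>b. W b \<subseteq> V b" "\<And>b. 2 * k + a \<le> card (W b)"
  shows "\<exists>p. distinct p \<and> successively E p \<and> set p \<subseteq> W True \<union> W False \<and> 2 * a \<le> length p + 1"
proof -
  have finW: "finite (W b)" for b using W fin finite_subset by metis
  obtain A p B where *: "A \<union> set p \<union> B = W True \<union> W False" "A \<inter> B = {}" "(A \<union> B) \<inter> set p = {}" "distinct p"
      "successively E p" "\<forall>a\<in>A. \<forall>b\<in>B. \<not> E a b" "card A = card B"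
    using depth_first_search_partition[of "W True \<union> W False" E] finW sym by auto
  have dW: "W True \<inter> W False = {}" using W disj by blast
  have split: "card X = card (X \<inter> W True) + card (X \<inter> W False)" if "X \<subseteq> W True \<union> W False" for X
  proof -
    have "X = (X \<inter> W True) \<union> (X \<inter> W False)" using that by blast
    then show ?thesis using finW dW card_Un_disjoint[of "X \<inter> W True" "X \<inter> W False"] by auto
  qed
  have parts: "card (W b) = card (A \<inter> W b) + card (B \<inter> W b) + card (set p \<inter> W b)" for b
  proof -
    have "W b = (A \<inter> W b) \<union> (B \<inter> W b) \<union> (set p \<inter> W b)" using *(1) by (cases b) auto
    moreover have "card \<dots> = card ((A \<inter> W b) \<union> (B \<inter> W b)) + card (set p \<inter> W b)"
      using *(2,3) finW by (intro card_Un_disjoint) auto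
    moreover have "card ((A \<inter> W b) \<union> (B \<inter> W b)) = card (A \<inter> W b) + card (B \<inter> W b)"
      using *(2,3) finW by (intro card_Un_disjoint) auto
    ultimately show ?thesis by simp
  qed
  have half: "2 * card (set p \<inter> W b) \<le> length p + 1" for b
  proof -
    have "successively (\<lambda>x y. \<not> (x \<in> W b \<and> y \<in> W b)) p"
      using *(5) by (rule successively_mono) (use cross W in blast)
    from alternating_list_filter_bound[OF this]
    show ?thesis using *(4) by (simp add: distinct_length_filter Int_commute)
  qed
  have small: "card (A \<inter> W b) < k \<or> card (B \<inter> W (\<not> b)) < k" for b
  proof (rule ccontr)
    assume "\<not> ?thesis"
    then have "k \<le> card (A \<inter> W b)" "k \<le> card (B \<inter> W (\<not> b))" by simp_all
    from joined[OF le_infI2[OF W(1)] le_infI2[OF W(1)] this]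
    obtain x y where "x \<in> A \<inter> W b" "y \<in> B \<inter> W (\<not> b)" "E x y" by blast
    then show False using *(6) by blast
  qed
  have "card A = card (A \<inter> W True) + card (A \<inter> W False)" by (rule split) (use *(1) in blast)
  moreover have "card B = card (B \<inter> W True) + card (B \<inter> W False)" by (rule split) (use *(1) in blast)
  moreover have "length p = card (set p \<inter> W True) + card (set p \<inter> W False)"
    unfolding distinct_card[OF *(4), symmetric] by (rule split) (use *(1) in blast)
  \<comment> \<open>If both parts of \<open>A\<close>, or both parts of \<open>B\<close>, are
    smaller than \<open>k\<close>, then \<open>card A = card B < 2 * k\<close> and the path contains
    the more than \<open>2 * a\<close> remaining vertices. Otherwise \<open>A\<close> and
    \<open>B\<close> are both smaller than \<open>k\<close> on one side, so the path has more than
    \<open>a\<close> vertices there, and it alternates between the sides.\<close>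
  ultimately have "2 * a \<le> length p + 1"
    using parts[of True] parts[of False] half[of True] half[of False] small[of True, simplified] small[of False, simplified]
      W(2)[of True] W(2)[of False] *(7) by linarith
  then show ?thesis using * by (intro exI[of _ p]) auto
qed

lemma side_of_nth:
  assumes "successively E p" "set p \<subseteq> V True \<union> V False" "j < length p" "p ! 0 \<in> V b"
  shows "p ! j \<in> V (b = even j)"
  using assms(3)
proof (induction j)
  case (Suc j)
  then have "p ! j \<in> V (b = even j)" by simp
  moreover have "E (p ! j) (p ! Suc j)" using assms(1) Suc.prems by (simp add: successively_conv_nth)
  ultimately have "p ! Suc j \<notin> V (b = even j)" by (rule cross[rotated])
  moreover have "p ! Suc j \<in> V True \<union> V False" using assms(2) Suc.prems nth_mem by blast
  moreover have "(b = even (Suc j)) = (\<not> (b = even j))" by auto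
  ultimately show ?case by (cases "b = even j") auto
qed (use assms in simp)

section \<open>Red cycles of exact even length\<close>

lemma even_cycle:
  assumes large: "\<And>b. 32 * k \<le> card (V b)" and "k \<ge> 2"
    and n: "even n" "2 * k \<le> n" "n \<le> 16 * k"
  shows "\<exists>C. distinct C \<and> length C = n \<and> set C \<subseteq> V True \<union> V False \<and> successively E (C @ [hd C])"
proof -
  \<comment> \<open>The \<open>32 * k\<close> vertices of a side are split into
    \<open>12 * k\<close> for the path and \<open>10 * k\<close> for each of the two tree
    regions.\<close>
  have "\<forall>b. \<exists>V0 U1 U2. V0 \<union> U1 \<union> U2 \<subseteq> V b \<and> V0 \<inter> U1 = {} \<and> V0 \<inter> U2 = {} \<and> U1 \<inter> U2 = {} \<and>
      card V0 = 12 * k \<and> card U1 = 10 * k \<and> card U2 = 10 * k"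
  proof
    fix b
    obtain V0 where V0: "V0 \<subseteq> V b" "card V0 = 12 * k"
      using large[of b] obtain_subset_with_card_n[of "12 * k" "V b"] by auto
    then have "card (V b - V0) \<ge> 20 * k"
      using large[of b] fin[of b] by (subst card_Diff_subset) (auto intro: finite_subset)
    then obtain U1 where U1: "U1 \<subseteq> V b - V0" "card U1 = 10 * k"
      using obtain_subset_with_card_n[of "10 * k" "V b - V0"] by auto
    then have "card (V b - V0 - U1) \<ge> 10 * k"
      using \<open>card (V b - V0) \<ge> 20 * k\<close> fin[of b] by (subst card_Diff_subset) (auto intro: finite_subset)
    then obtain U2 where U2: "U2 \<subseteq> V b - V0 - U1" "card U2 = 10 * k"
      using obtain_subset_with_card_n[of "10 * k" "V b - V0 - U1"] by auto
    show "\<exists>V0 U1 U2. V0 \<union> U1 \<union> U2 \<subseteq> V b \<and> V0 \<inter> U1 = {} \<and> V0 \<inter> U2 = {} \<and> U1 \<inter> U2 = {} \<and>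
      card V0 = 12 * k \<and> card U1 = 10 * k \<and> card U2 = 10 * k"
      by (rule exI[of _ V0], rule exI[of _ U1], rule exI[of _ U2]) (use V0 U1 U2 in auto)
  qed
  from this[unfolded choice_iff] obtain V0 U1 U2 where
    *: "\<forall>b. V0 b \<union> U1 b \<union> U2 b \<subseteq> V b \<and> V0 b \<inter> U1 b = {} \<and> V0 b \<inter> U2 b = {} \<and> U1 b \<inter> U2 b = {} \<and>
      card (V0 b) = 12 * k \<and> card (U1 b) = 10 * k \<and> card (U2 b) = 10 * k" by (elim exE)
  have sub: "V0 b \<subseteq> V b" "U1 b \<subseteq> V b" "U2 b \<subseteq> V b"
    and parts: "V0 b \<inter> U1 b = {}" "V0 b \<inter> U2 b = {}" "U1 b \<inter> U2 b = {}"
    and cards: "card (V0 b) = 12 * k" "card (U1 b) = 10 * k" "card (U2 b) = 10 * k" for b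
    using *[rule_format, of b] by simp_all
  \<comment> \<open>The region \<open>U1\<close> is cleaned along with \<open>V0\<close>, since
    every level of a tree after its root lies in the region and must expand as well.\<close>
  have "\<exists>B. \<forall>b. B b \<subseteq> V0 b \<union> U1 b \<and> card (B b) < k \<and>
    (\<forall>X \<subseteq> V0 b \<union> U1 b - B b. card X \<le> k \<longrightarrow> 4 * card X \<le> card (nbhd X (U1 (\<not> b) - B (\<not> b))))"
    by (rule expanding_cleanup) (use sub cards \<open>k \<ge> 2\<close> in auto)
  then obtain B1 where *: "\<forall>b. B1 b \<subseteq> V0 b \<union> U1 b \<and> card (B1 b) < k \<and>
    (\<forall>X \<subseteq> V0 b \<union> U1 b - B1 b. card X \<le> k \<longrightarrow> 4 * card X \<le> card (nbhd X (U1 (\<not> b) - B1 (\<not> b))))"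
    by (elim exE)
  have B1: "B1 b \<subseteq> V0 b \<union> U1 b" "card (B1 b) < k"
    "X \<subseteq> V0 b \<union> U1 b - B1 b \<Longrightarrow> card X \<le> k \<Longrightarrow> 4 * card X \<le> card (nbhd X (U1 (\<not> b) - B1 (\<not> b)))" for b X
    using *[rule_format, of b] by simp_all
  have "\<exists>B. \<forall>b. B b \<subseteq> V0 b \<union> U2 b \<and> card (B b) < k \<and>
    (\<forall>X \<subseteq> V0 b \<union> U2 b - B b. card X \<le> k \<longrightarrow> 4 * card X \<le> card (nbhd X (U2 (\<not> b) - B (\<not> b))))"
    by (rule expanding_cleanup) (use sub cards \<open>k \<ge> 2\<close> in auto)
  then obtain B2 where *: "\<forall>b. B2 b \<subseteq> V0 b \<union> U2 b \<and> card (B2 b) < k \<and>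
    (\<forall>X \<subseteq> V0 b \<union> U2 b - B2 b. card X \<le> k \<longrightarrow> 4 * card X \<le> card (nbhd X (U2 (\<not> b) - B2 (\<not> b))))"
    by (elim exE)
  have B2: "B2 b \<subseteq> V0 b \<union> U2 b" "card (B2 b) < k"
    "X \<subseteq> V0 b \<union> U2 b - B2 b \<Longrightarrow> card X \<le> k \<Longrightarrow> 4 * card X \<le> card (nbhd X (U2 (\<not> b) - B2 (\<not> b)))" for b X
    using *[rule_format, of b] by simp_all
  define W where "W b = V0 b - (B1 b \<union> B2 b)" for b
  \<comment> \<open>Two cleanups remove at most \<open>2 * (k - 1)\<close> of the
    \<open>12 * k\<close> vertices.\<close>
  have cW: "2 * k + (8 * k + 2) \<le> card (W b)" for b
  proof -
    have "B1 b \<union> B2 b \<subseteq> V b" using B1(1)[of b] B2(1)[of b] sub[of b] by blast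
    then have "finite (B1 b \<union> B2 b)" using fin by (rule finite_subset)
    then have "card (V0 b) - card (B1 b \<union> B2 b) \<le> card (W b)"
      unfolding W_def by (rule diff_card_le_card_Diff)
    then show ?thesis using B1(2)[of b] B2(2)[of b] card_Un_le[of "B1 b" "B2 b"] cards(1)[of b] by linarith
  qed
  have WV: "W b \<subseteq> V b" for b using sub(1)[of b] by (auto simp: W_def)
  obtain p where p: "distinct p" "successively E p" "set p \<subseteq> W True \<union> W False" "16 * k \<le> length p"
    using long_path[of W "8 * k + 2", OF WV cW] by auto
  \<comment> \<open>Minimality serves twice: the \<open>2 ^ h\<close> leaves are enough for
    \<open>joined\<close>, and all earlier levels have at most \<open>k\<close> vertices, as
    expansion requires.\<close>
  define h where "h = (LEAST h. k \<le> 2 ^ h)"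
  have h: "k \<le> 2 ^ h" unfolding h_def by (rule LeastI[of _ k]) (simp add: less_imp_le)
  have hmin: "2 ^ j \<le> k" if "j < h" for j
    using not_less_Least[of j "\<lambda>h. k \<le> 2 ^ h"] that by (simp add: h_def)
  have "h > 0" using h \<open>k \<ge> 2\<close> by (cases h) auto
  have "k \<le> 2 ^ (k - 1)" using less_exp[of "k - 1"] by linarith
  then have "h \<le> k - 1" unfolding h_def by (rule Least_le)
  then have hk: "h < k" using \<open>k \<ge> 2\<close> by simp
  \<comment> \<open>The two trees contribute \<open>h\<close> vertices each besides their roots,
    which are the ends of the path. From \<open>h < k\<close> and \<open>2 * k \<le> n\<close>
    follows \<open>l \<ge> 2\<close>, and as \<open>l\<close> is even the roots lie on opposite
    sides.\<close>
  define l where "l = n - 2 * h"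
  have l: "l + 2 * h = n" "l \<ge> 2" "even l" "l \<le> length p" using n hk p(4) by (auto simp: l_def)
  define Q where "Q = take l p"
  have Q: "length Q = l" "distinct Q" "set Q \<subseteq> W True \<union> W False" "successively E Q"
    using p l(4) set_take_subset[of l p] append_take_drop_id[of l p] successively_append_iff[of E "take l p" "drop l p"]
    by (auto simp: Q_def)
  define u w where "u = Q ! 0" and "w = Q ! (l - 1)"
  have "u \<in> set Q" "w \<in> set Q" using l Q(1) by (auto simp: u_def w_def)
  then obtain b where b: "u \<in> W b" using Q(3) by auto
  have "w \<in> V (b = even (l - 1))"
    unfolding w_def using Q WV b l by (intro side_of_nth) (auto simp: u_def)
  moreover have "odd (l - 1)" using l by auto
  ultimately have "w \<in> V (\<not> b)" by simp
  then have wW: "w \<in> W (\<not> b)" using \<open>w \<in> set Q\<close> Q(3) WV sides_disjoint[of b] by (cases b) auto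
  have "\<exists>X Z. X \<subseteq> V0 (b = even h) \<union> U1 (b = even h) - B1 (b = even h) \<and> card X = 2 ^ h \<and>
      Z \<subseteq> (U1 True - B1 True) \<union> (U1 False - B1 False) \<and> card Z \<le> 2 * 2 ^ h \<and> (\<forall>x\<in>X. linked u Z h x)"
  proof (rule expanding_tree[where G = "\<lambda>b. V0 b \<union> U1 b - B1 b" and U = "\<lambda>b. U1 b - B1 b"])
    show "V0 b \<union> U1 b - B1 b \<subseteq> V b" for b using sub[of b] by blast
    show "u \<in> V0 b \<union> U1 b - B1 b" "u \<notin> U1 b - B1 b"
      using b parts(1)[of "b"] by (auto simp: W_def)
  qed (rule B1(3), auto intro: hmin)
  then obtain X Z1 where X: "X \<subseteq> V0 (b = even h) \<union> U1 (b = even h) - B1 (b = even h)" "card X = 2 ^ h"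
    "Z1 \<subseteq> (U1 True - B1 True) \<union> (U1 False - B1 False)" "\<forall>x\<in>X. linked u Z1 h x"
    by (elim exE conjE)
  have "\<exists>X Z. X \<subseteq> V0 ((\<not> b) = even h) \<union> U2 ((\<not> b) = even h) - B2 ((\<not> b) = even h) \<and> card X = 2 ^ h \<and>
      Z \<subseteq> (U2 True - B2 True) \<union> (U2 False - B2 False) \<and> card Z \<le> 2 * 2 ^ h \<and> (\<forall>x\<in>X. linked w Z h x)"
  proof (rule expanding_tree[where G = "\<lambda>b. V0 b \<union> U2 b - B2 b" and U = "\<lambda>b. U2 b - B2 b"])
    show "V0 b \<union> U2 b - B2 b \<subseteq> V b" for b using sub[of b] by blast
    show "w \<in> V0 (\<not> b) \<union> U2 (\<not> b) - B2 (\<not> b)" "w \<notin> U2 (\<not> b) - B2 (\<not> b)"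
      using wW parts(2)[of "(\<not> b)"] by (auto simp: W_def)
  qed (rule B2(3), auto intro: hmin)
  then obtain Y Z2 where Y: "Y \<subseteq> V0 ((\<not> b) = even h) \<union> U2 ((\<not> b) = even h) - B2 ((\<not> b) = even h)" "card Y = 2 ^ h"
    "Z2 \<subseteq> (U2 True - B2 True) \<union> (U2 False - B2 False)" "\<forall>x\<in>Y. linked w Z2 h x"
    by (elim exE conjE)
  \<comment> \<open>Roots on opposite sides and equal depths put the two sets of leaves on opposite
    sides.\<close>
  have side: "((\<not> b) = even h) = (\<not> (b = even h))" by auto
  have "\<exists>x\<in>X. \<exists>y\<in>Y. E x y"
  proof (rule joined)
    show "X \<subseteq> V (b = even h)" using X(1) sub[of "b = even h"] by blast
    show "Y \<subseteq> V (\<not> (b = even h))" using Y(1) sub[of "\<not> (b = even h)"] unfolding side by blast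
  qed (use X(2) Y(2) h in auto)
  then obtain x y where xy: "x \<in> X" "y \<in> Y" "E x y" by blast
  from bspec[OF X(4) xy(1)] obtain q1 where q1: "length q1 = h" "distinct (q1 @ [u])" "set q1 \<subseteq> Z1"
    "successively E (q1 @ [u])" "hd (q1 @ [u]) = x" unfolding linked_def by blast
  from bspec[OF Y(4) xy(2)] obtain q2 where q2: "length q2 = h" "distinct (q2 @ [w])" "set q2 \<subseteq> Z2"
    "successively E (q2 @ [w])" "hd (q2 @ [w]) = y" unfolding linked_def by blast
  have ne: "q1 \<noteq> []" "q2 \<noteq> []" "Q \<noteq> []" using q1 q2 Q l \<open>h > 0\<close> by auto
  have ends: "hd Q = u" "last Q = w" using ne Q(1) by (auto simp: u_def w_def hd_conv_nth last_conv_nth)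
  \<comment> \<open>The cycle runs from the leaf \<open>x\<close> to \<open>u\<close>, along
    \<open>Q\<close> to \<open>w\<close> and out to the leaf \<open>y\<close>; the edge between
    \<open>y\<close> and \<open>x\<close> closes it. The roots \<open>u\<close> and \<open>w\<close>
    are counted in \<open>Q\<close> only.\<close>
  define C where "C = q1 @ Q @ rev q2"
  have cross_disj: "V0 b \<inter> U1 b' = {}" "V0 b \<inter> U2 b' = {}" "U1 b \<inter> U2 b' = {}" for b b'
  proof -
    have "(V0 b \<inter> U1 b' = {} \<and> V0 b \<inter> U2 b' = {}) \<and> U1 b \<inter> U2 b' = {}"
    proof (cases "b' = b")
      case False
      then have "b' = (\<not> b)" by auto
      then show ?thesis using sub[of b] sub[of b'] sides_disjoint[of b] by blast
    qed (simp add: parts)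
    then show "V0 b \<inter> U1 b' = {}" "V0 b \<inter> U2 b' = {}" "U1 b \<inter> U2 b' = {}" by simp_all
  qed
  have "set Q \<subseteq> V0 True \<union> V0 False" using Q(3) by (auto simp: W_def)
  then have sets: "set Q \<inter> set q1 = {}" "set Q \<inter> set q2 = {}" "set q1 \<inter> set q2 = {}"
    using q1(3) q2(3) X(3) Y(3) cross_disj by blast+
  show ?thesis
  proof (intro exI[of _ C] conjI)
    show "distinct C" using q1(2) q2(2) Q(2) sets by (auto simp: C_def)
    show "length C = n" using q1(1) q2(1) Q(1) l(1) by (simp add: C_def)
    show "set C \<subseteq> V True \<union> V False"
      using q1(3) q2(3) X(3) Y(3) Q(3) sub[of True] sub[of False] WV[of True] WV[of False]
      by (auto simp: C_def)
    have "successively E (rev (q2 @ [w]))"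
      unfolding successively_rev using q2(4) by (rule successively_mono) (rule sym)
    then show "successively E (C @ [hd C])"
      using q1 q2 Q(4) ne ends xy(3) sym
      by (auto simp: C_def successively_append_iff last_rev successively_Cons hd_append)
  qed
qed

end

section \<open>From lists to copies, and the choice of constants\<close>

definition contains_path :: "'a ugraph \<Rightarrow> 'a list \<Rightarrow> bool" where
  "contains_path G p \<longleftrightarrow> distinct p \<and> set p \<subseteq> verts G \<and> successively (\<lambda>x y. {x, y} \<in> edges G) p"

lemma contains_path_graph:
  assumes "contains_path G p" "n \<le> length p"
  shows "contains_copy G (path_graph n)"
  unfolding contains_copy_def path_graph_def
proof (intro exI[of _ "\<lambda>i. p ! i"] conjI)
  show "inj_on ((!) p) (verts \<lparr>verts = {..<n}, edges = {{i, i + 1} |i. i + 1 < n}\<rparr>)"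
    using assms by (auto simp: inj_on_def contains_path_def nth_eq_iff_index_eq)
qed (use assms in \<open>auto simp: contains_path_def successively_conv_nth\<close>)

lemma contains_cycle_graph:
  assumes "distinct C" "set C \<subseteq> verts G" "successively (\<lambda>x y. {x, y} \<in> edges G) (C @ [hd C])"
  shows "contains_copy G (cycle_graph (length C))"
  unfolding contains_copy_def cycle_graph_def
proof (intro exI[of _ "\<lambda>i. C ! i"] conjI)
  have "{C ! i, C ! ((i + 1) mod length C)} \<in> edges G" if "i < length C" for i
  proof -
    have "{(C @ [hd C]) ! i, (C @ [hd C]) ! Suc i} \<in> edges G"
      using assms(3) that by (simp add: successively_conv_nth)
    moreover have "hd C = C ! 0" using that by (intro hd_conv_nth) auto
    ultimately show ?thesis using that
      by (cases "Suc i = length C") (auto simp: nth_append)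
  qed
  then show "\<forall>e\<in>edges \<lparr>verts = {..<length C}, edges = {{i, (i + 1) mod length C} |i. i < length C}\<rparr>.
      (!) C ` e \<in> edges G" by auto
qed (use assms in \<open>auto simp: inj_on_def nth_eq_iff_index_eq\<close>)

lemma joined_graph_arrows:
  fixes H :: "nat set set"
  assumes joined: "\<And>A B. A \<subseteq> {..<80 * k} \<Longrightarrow> B \<subseteq> {..<80 * k} \<Longrightarrow> A \<inter> B = {} \<Longrightarrow> k \<le> card A \<Longrightarrow> k \<le> card B \<Longrightarrow>
      \<exists>a\<in>A. \<exists>b\<in>B. {a, b} \<in> H"
    and k: "k \<ge> 2" and n: "even n" "2 * k \<le> n" "n \<le> 16 * k"
  shows "arrows \<lparr>verts = {..<80 * k}, edges = H\<rparr> (cycle_graph n) (path_graph n)"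
  unfolding arrows_def
proof
  fix c
  let ?G = "\<lparr>verts = {..<80 * k}, edges = H\<rparr>"
  let ?R = "colour_class ?G c Red" and ?B = "colour_class ?G c Blue"
  show "contains_copy ?R (cycle_graph n) \<or> contains_copy ?B (path_graph n)"
  proof (rule disjCI)
    assume noblue: "\<not> contains_copy ?B (path_graph n)"
    have "\<exists>A p B. A \<union> set p \<union> B = {..<80 * k} \<and> A \<inter> B = {} \<and> (A \<union> B) \<inter> set p = {} \<and> distinct p \<and>
        successively (\<lambda>x y. {x, y} \<in> edges ?B) p \<and> (\<forall>a\<in>A. \<forall>b\<in>B. {a, b} \<notin> edges ?B) \<and> card A = card B"
      by (rule depth_first_search_partition) (auto simp: insert_commute)
    then obtain S p T where ST: "S \<union> set p \<union> T = {..<80 * k}" "S \<inter> T = {}" "(S \<union> T) \<inter> set p = {}" "distinct p"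
      "successively (\<lambda>x y. {x, y} \<in> edges ?B) p" "\<And>s t. s \<in> S \<Longrightarrow> t \<in> T \<Longrightarrow> {s, t} \<notin> edges ?B" "card S = card T"
      by blast
    have "contains_path ?B p" using ST by (auto simp: contains_path_def colour_class_def)
    then have "length p < n" using noblue contains_path_graph not_le by blast
    have fin: "finite S" "finite T" using ST(1) by (metis finite_Un finite_lessThan)+
    have "80 * k = card (S \<union> T \<union> set p)" using ST(1) by (metis card_lessThan sup.assoc sup.commute)
    also have "\<dots> = card S + card T + length p"
      using fin ST(2,3) by (simp add: card_Un_disjoint distinct_card[OF ST(4)])
    \<comment> \<open>Since \<open>length p < n \<le> 16 * k\<close>, the equal sets
      \<open>S\<close> and \<open>T\<close> share more than \<open>64 * k\<close> vertices.\<close>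
    finally have cS: "32 * k \<le> card S" "32 * k \<le> card T" using ST(7) n \<open>length p < n\<close> by auto
    define V where "V b = (if b then S else T)" for b
    \<comment> \<open>All edges of \<open>H\<close> between \<open>S\<close> and \<open>T\<close>
      are kept, so \<open>joined\<close> carries over; they are red because the search leaves no
      blue edge there.\<close>
    define E where "E x y \<longleftrightarrow> {x, y} \<in> H \<and> (x \<in> S \<and> y \<in> T \<or> x \<in> T \<and> y \<in> S)" for x y
    have redge: "{x, y} \<in> edges ?R" if "E x y" for x y
    proof -
      have "{x, y} \<notin> edges ?B" using that ST(6)[of x y] ST(6)[of y x] by (auto simp: E_def insert_commute)
      then show ?thesis using that by (cases "c {x, y}") (auto simp: E_def colour_class_def)
    qed
    interpret bipartite_relation V E k
    proof
      fix A C b assume AC: "A \<subseteq> V b" "C \<subseteq> V (\<not> b)" "k \<le> card A" "k \<le> card C"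
      have "\<exists>x\<in>A. \<exists>y\<in>C. {x, y} \<in> H" using AC ST(1,2) by (intro joined) (auto simp: V_def split: if_splits)
      then show "\<exists>x\<in>A. \<exists>y\<in>C. E x y" using AC(1,2) by (auto simp: E_def V_def split: if_splits)
    qed (use ST(2) fin in \<open>auto simp: E_def V_def insert_commute split: if_splits\<close>)
    have "32 * k \<le> card (V b)" for b using cS by (simp add: V_def)
    from even_cycle[OF this k n]
    obtain C where C: "distinct C" "length C = n" "set C \<subseteq> V True \<union> V False" "successively E (C @ [hd C])"
      by blast
    have "successively (\<lambda>x y. {x, y} \<in> edges ?R) (C @ [hd C])"
      using C(4) by (rule successively_mono) (rule redge)
    moreover have "set C \<subseteq> verts ?R" using C(3) ST(1) by (auto simp: V_def colour_class_def)
    ultimately show "contains_copy ?R (cycle_graph n)" using contains_cycle_graph[of C ?R] C(1,2) by simp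
  qed
qed

theorem theorem6p1:
  shows "\<exists>N. \<forall>n\<ge>N. even n \<longrightarrow> size_ramsey (cycle_graph n) (path_graph n) \<le> enat (2257 * n)"
proof (intro exI[of _ 618] allI impI)
  fix n :: nat assume n: "618 \<le> n" "even n"
  define k where "k = n div 16 + 1"
  \<comment> \<open>As \<open>35200 = 16 * 2200\<close>, the last bound follows from
    \<open>2200 * n + 35200 \<le> 2257 * n\<close>, which holds from \<open>n = 618\<close>
    on.\<close>
  have k: "n \<le> 16 * k" "2 * k \<le> n" "k \<ge> 2" "35200 * k \<le> 2257 * n" using n by (auto simp: k_def)
  \<comment> \<open>The edge count is \<open>80\<^sup>2 * k * (11 / 2)\<close>, which is admissible because \<open>ln 80 < 9 / 2\<close>.\<close>
  have "(80::real) < exp (9 / 2)"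
  proof -
    \<comment> \<open>The quadratic Taylor bound is taken at \<open>1/4\<close>, where it is sharp
      enough, and raised to the power \<open>18 = (9/2) / (1/4)\<close>.\<close>
    have "(80::real) < (1 + 1/4 + (1/4)^2 / 2) ^ 18" by (simp add: field_simps power2_eq_square)
    also have "\<dots> \<le> exp (1/4) ^ 18" by (intro power_mono exp_lower_Taylor_quadratic) auto
    also have "\<dots> = exp (9 / 2)" by (simp flip: exp_of_nat_mult)
    finally show ?thesis .
  qed
  then have "ln 80 < (9 / 2 :: real)" by (metis exp_gt_zero ln_exp ln_less_cancel_iff zero_less_numeral)
  then have "(real 80)\<^sup>2 * k * (1 + ln (real 80)) < real (35200 * k)" using k by simp
  then have "real (80\<^sup>2 * k) * (1 + ln (real 80)) < real (35200 * k)" by simp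
  from sparse_joined_graph_exists[OF _ _ this] k(3)
  obtain H where H: "H \<subseteq> [{..<80 * k}]\<^bsup>2\<^esup>" "card H \<le> 35200 * k"
    "\<And>A B. A \<subseteq> {..<80 * k} \<Longrightarrow> B \<subseteq> {..<80 * k} \<Longrightarrow> A \<inter> B = {} \<Longrightarrow> k \<le> card A \<Longrightarrow> k \<le> card B \<Longrightarrow>
      \<exists>a\<in>A. \<exists>b\<in>B. {a, b} \<in> H"
    by auto
  show "size_ramsey (cycle_graph n) (path_graph n) \<le> enat (2257 * n)"
    unfolding size_ramsey_le_iff
  proof (intro exI[of _ "\<lparr>verts = {..<80 * k}, edges = H\<rparr>"] conjI)
    show "arrows \<lparr>verts = {..<80 * k}, edges = H\<rparr> (cycle_graph n) (path_graph n)"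
      using H(3) k n by (intro joined_graph_arrows) auto
  qed (use H k in \<open>auto simp: finite_simple_graph_def\<close>)
qed

end
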